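(* Let $P$ be a finite graded bounded poset of rank $r\ge1$, and write its $\chi$-Chow polynomial as $\mathrm{H}_P(x)=\sum_{i=0}^{\lfloor(r-1)/2\rfloor}\gamma_i\,x^i(1+x)^{r-1-2i}$ with $\gamma_i\in\mathbb{Z}$, and set $\gamma_P(x)=\sum_i\gamma_ix^i$. Then $$\gamma_P(x)=\sum_{S\subseteq[r-1],\ S\text{ good}}\beta_P(S)\,x^{|S|}.$$
   Context: For a finite graded bounded poset $P$ with rank function $\rho$ ($\rho_{st}=\rho(t)-\rho(s)$, rank $r=\rho(\widehat1)$), the characteristic function is $\chi_{st}(x)=\sum_{s\le w\le t}\mu_{sw}x^{\rho_{wt}}$ (Möbius function $\mu$), an element of the incidence algebra (maps $[s,t]\mapsto a_{st}(x)\in\mathbb{Z}[x]$ with product $(ab)_{st}=\sum_{s\le w\le t}a_{sw}b_{wt}$). For $s<t$, $\chi_{st}$ is divisible by $x-1$; let $\overline{\chi}_{st}=\chi_{st}/(x-1)$ for $s<t$ and $\overline{\chi}_{ss}=-1$. The $\chi$-Chow function is $\mathrm{H}=-(\overline{\chi})^{-1}$ and $\mathrm{H}_P=\mathrm{H}_{\widehat0\widehat1}$; $\mathrm{H}_P$ is symmetric with center $(r-1)/2$, so the $\gamma_i$ exist uniquely. For $S=\{s_1<\dots<s_m\}\subseteq[r-1]=\{1,\dots,r-1\}$, the flag $f$-vector $\alpha_P(S)$ is the number of chains $w_1<\dots<w_m$ in $P$ with $\rho(w_i)=s_i$; the flag $h$-vector is $\beta_P(S)=\sum_{T\subseteq S}(-1)^{|S|-|T|}\alpha_P(T)$.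 A set $S\subseteq\mathbb{Z}$ is good if it contains neither $1$ nor two consecutive integers. *)

theory Defs
  imports
    "HOL-Algebra.Ring"
    "HOL-Computational_Algebra.Polynomial"
begin

section \<open>Finite graded bounded posets\<close>

text \<open>
  The rank function is a parameter of the locale; it is determined by the poset through
  the last two assumptions, and its existence is the gradedness of the poset.
\<close>

definition covers :: "('a, 'm) gorder_scheme \<Rightarrow> 'a \<Rightarrow> 'a \<Rightarrow> bool" where
  "covers L t s \<longleftrightarrow> s \<in> carrier L \<and> t \<in> carrier L \<and> s \<sqsubset>\<^bsub>L\<^esub> t \<and>
     \<not> (\<exists>w\<in>carrier L. s \<sqsubset>\<^bsub>L\<^esub> w \<and> w \<sqsubset>\<^bsub>L\<^esub> t)"

locale finite_graded_bounded_poset =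
  partial_order L + weak_partial_order_bottom L + weak_partial_order_top L
  for L (structure) +
  fixes \<rho> :: "'a \<Rightarrow> nat"
  assumes finite_carrier: "finite (carrier L)"
    and rank_bottom: "\<rho> \<bottom> = 0"
    and rank_covers: "covers L t s \<Longrightarrow> \<rho> t = \<rho> s + 1"


section \<open>The incidence algebra\<close>

text \<open>
  A map on the intervals \<open>[s, t]\<close> is encoded as a function of the two endpoints that vanishes
  whenever \<open>(s, t)\<close> is not a pair of comparable elements of the poset.
\<close>

definition incidence_algebra ::
    "('a, 'm) gorder_scheme \<Rightarrow> ('a \<Rightarrow> 'a \<Rightarrow> 'b :: comm_ring_1) ring" where
  "incidence_algebra L =
     \<lparr> carrier = {a. \<forall>s t. \<not> (s \<in> carrier L \<and> t \<in> carrier L \<and> s \<sqsubseteq>\<^bsub>L\<^esub> t) \<longrightarrow> a s t = 0},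
       monoid.mult = (\<lambda>a b s t. \<Sum>w\<in>\<lbrace>s..t\<rbrace>\<^bsub>L\<^esub>. a s w * b w t),
       monoid.one = (\<lambda>s t. if s \<in> carrier L \<and> s = t then 1 else 0),
       ring.zero = (\<lambda>s t. 0),
       ring.add = (\<lambda>a b s t. a s t + b s t) \<rparr>"

definition zeta :: "('a, 'm) gorder_scheme \<Rightarrow> 'a \<Rightarrow> 'a \<Rightarrow> int" where
  "zeta L s t = (if s \<in> carrier L \<and> t \<in> carrier L \<and> s \<sqsubseteq>\<^bsub>L\<^esub> t then 1 else 0)"

definition moebius :: "('a, 'm) gorder_scheme \<Rightarrow> 'a \<Rightarrow> 'a \<Rightarrow> int" where
  "moebius L = inv\<^bsub>incidence_algebra L\<^esub> (zeta L)"


section \<open>The characteristic function and the Chow function\<close>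

text \<open>The subtraction of ranks is never truncated, since \<open>w \<sqsubseteq> t\<close>.\<close>

definition char_fun :: "('a, 'm) gorder_scheme \<Rightarrow> ('a \<Rightarrow> nat) \<Rightarrow> 'a \<Rightarrow> 'a \<Rightarrow> int poly" where
  "char_fun L \<rho> s t =
     (if s \<in> carrier L \<and> t \<in> carrier L \<and> s \<sqsubseteq>\<^bsub>L\<^esub> t
      then \<Sum>w\<in>\<lbrace>s..t\<rbrace>\<^bsub>L\<^esub>. monom (moebius L s w) (\<rho> t - \<rho> w) else 0)"

text \<open>The division by \<open>x - 1\<close> (written \<open>[:-1, 1:]\<close>) is exact for \<open>s \<sqsubset> t\<close>.\<close>

definition reduced_char_fun ::
    "('a, 'm) gorder_scheme \<Rightarrow> ('a \<Rightarrow> nat) \<Rightarrow> 'a \<Rightarrow> 'a \<Rightarrow> int poly" where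
  "reduced_char_fun L \<rho> s t =
     (if s \<in> carrier L \<and> s = t then -1 else char_fun L \<rho> s t div [:-1, 1:])"

definition chow_fun :: "('a, 'm) gorder_scheme \<Rightarrow> ('a \<Rightarrow> nat) \<Rightarrow> 'a \<Rightarrow> 'a \<Rightarrow> int poly" where
  "chow_fun L \<rho> s t = - (inv\<^bsub>incidence_algebra L\<^esub> (reduced_char_fun L \<rho>)) s t"

definition chow_poly :: "('a, 'm) gorder_scheme \<Rightarrow> ('a \<Rightarrow> nat) \<Rightarrow> int poly" where
  "chow_poly L \<rho> = chow_fun L \<rho> \<bottom>\<^bsub>L\<^esub> \<top>\<^bsub>L\<^esub>"


section \<open>Flag vectors\<close>

text \<open>
  A chain \<open>w\<^sub>1 \<sqsubset> \<dots> \<sqsubset> w\<^sub>m\<close> is encoded as the set of its elements. Ranks strictly increase along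
  a chain, so \<open>\<rho> ` C = S\<close> says that the ranks of its elements, in order, are those in \<open>S\<close>.
\<close>

definition flag_f :: "('a, 'm) gorder_scheme \<Rightarrow> ('a \<Rightarrow> nat) \<Rightarrow> nat set \<Rightarrow> nat" where
  "flag_f L \<rho> S =
     card {C. C \<subseteq> carrier L \<and> Complete_Partial_Order.chain (le L) C \<and> \<rho> ` C = S}"

definition flag_h :: "('a, 'm) gorder_scheme \<Rightarrow> ('a \<Rightarrow> nat) \<Rightarrow> nat set \<Rightarrow> int" where
  "flag_h L \<rho> S = (\<Sum>T\<in>Pow S. (-1) ^ (card S - card T) * int (flag_f L \<rho> T))"

definition good :: "nat set \<Rightarrow> bool" where
  "good S \<longleftrightarrow> 1 \<notin> S \<and> \<not> (\<exists>i. i \<in> S \<and> i + 1 \<in> S)"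

end

theory Submission
  imports Defs
begin

text \<open>
  Let \<open>M\<close> have the entries \<open>x + \<dots> + x\<^sup>k\<^sup>-\<^sup>1\<close> on intervals of rank \<open>k\<close>, and let \<open>Z\<close> be the zeta
  function. Clearing the denominator \<open>x - 1\<close> in the definition of the Chow function \<open>H\<close> gives
  \<open>(1 - M) H = Z\<close>, hence \<open>H = F Z\<close> where \<open>F = 1 + F M\<close>. Let \<open>\<beta>\<^sub>t\<close> be the flag h-vector of the
  interval from \<open>\<bottom>\<close> to \<open>t\<close>, and let \<open>Q\<^sub>t(n)\<close> be the sum of \<open>\<beta>\<^sub>t(S) x^|S| (1+x)^(n-1-2|S|)\<close> over the
  good \<open>S \<subseteq> {1..n-1}\<close>, with \<open>Q\<^sub>t(0) = 0\<close>. Removing the largest element of a good set, together with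
  \<open>\<Sum>\<^sub>w \<beta>\<^sub>w(S) = \<beta>\<^sub>t(S \<union> {s}) + \<beta>\<^sub>t(S)\<close> (sum over the \<open>w \<sqsubset> t\<close> of rank \<open>s > max S\<close>), shows that the
  sum of \<open>x Q\<^sub>w(s-1)\<close> over these \<open>w\<close> is \<open>Q\<^sub>t(s+1) - (1+x) Q\<^sub>t(s) + x Q\<^sub>t(s-1)\<close>. These level sums
  telescope, so that \<open>x Q\<^sub>w(\<rho>(w)-1)\<close> is the row of \<open>F\<close> at \<open>\<bottom>\<close>, and \<open>H\<close> takes the value \<open>Q\<^sub>t(\<rho>(t))\<close>
  on the interval from \<open>\<bottom>\<close> to \<open>t\<close>.
\<close>

section \<open>Good sets\<close>

lemma goodD1: "good S \<Longrightarrow> 1 \<notin> S"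
  and goodD2: "good S \<Longrightarrow> i \<in> S \<Longrightarrow> Suc i \<notin> S"
  unfolding good_def by auto

lemma good_empty [simp]: "good {}"
  by (simp add: good_def)

lemma good_subset: "good S \<Longrightarrow> T \<subseteq> S \<Longrightarrow> good T"
  unfolding good_def by blast

lemma good_insert_Suc_Suc:
  assumes "S \<subseteq> {1..n}"
  shows "good (insert (Suc (Suc n)) S) \<longleftrightarrow> good S"
proof -
  have "i \<le> n" if "i \<in> S" for i using that assms by auto
  then show ?thesis unfolding good_def by fastforce
qed

text \<open>Split by membership of \<open>n + 2\<close>: a good set containing it omits
  \<open>n + 1\<close>, so the rest lies in \<open>{1..n}\<close>. This Fibonacci-type recursion
  yields both \<open>card_good\<close> and the recursion for \<open>good_poly\<close>.\<close>

lemma good_sets_Suc_Suc: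
  "{S. S \<subseteq> {1..Suc (Suc n)} \<and> good S} =
   {S. S \<subseteq> {1..Suc n} \<and> good S} \<union> insert (Suc (Suc n)) ` {S. S \<subseteq> {1..n} \<and> good S}"
  (is "?A = ?B \<union> ?C")
proof
  show "?A \<subseteq> ?B \<union> ?C"
  proof
    fix S assume S: "S \<in> ?A"
    show "S \<in> ?B \<union> ?C"
    proof (cases "Suc (Suc n) \<in> S")
      case False
      then have "S \<subseteq> {1..Suc n}" using S by (fastforce simp: le_Suc_eq)
      then show ?thesis using S by blast
    next
      case True
      moreover have "Suc n \<notin> S" using S True goodD2 by blast
      ultimately have "S - {Suc (Suc n)} \<subseteq> {1..n}" using S by (fastforce simp: le_Suc_eq)
      moreover have "good (S - {Suc (Suc n)})" using S good_subset by blast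
      moreover have "S = insert (Suc (Suc n)) (S - {Suc (Suc n)})" using True by blast
      ultimately show ?thesis by blast
    qed
  qed
  show "?B \<union> ?C \<subseteq> ?A" using good_insert_Suc_Suc by fastforce
qed

lemma good_sets_1: "{S. S \<subseteq> {1..Suc 0} \<and> good S} = {{}}"
  by (auto simp: subset_singleton_iff dest: goodD1)

text \<open>Guarantees that the exponent \<open>n - 2 * card S\<close> in \<open>good_poly\<close>
  is never truncated.\<close>

lemma card_good:
  assumes "S \<subseteq> {1..n}" "good S"
  shows "2 * card S \<le> n"
  using assms
proof (induction n arbitrary: S rule: induct_nat_012)
  case 0
  then show ?case by simp
next
  case 1
  then have "S = {}" using good_sets_1 by blast
  then show ?case by simp
next
  case (ge2 n)
  then have "S \<in> {S. S \<subseteq> {1..Suc n} \<and> good S} \<union> insert (Suc (Suc n)) ` {S. S \<subseteq> {1..n} \<and> good S}"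
    unfolding good_sets_Suc_Suc[symmetric] by simp
  then consider "S \<subseteq> {1..Suc n}"
    | T where "T \<subseteq> {1..n}" "good T" "S = insert (Suc (Suc n)) T"
    by (elim UnE imageE CollectE conjE) (assumption | blast)+
  then show ?case
  proof cases
    case 1
    show ?thesis using ge2.IH(2)[OF 1 ge2.prems(2)] by linarith
  next
    case (2 T)
    have "card S \<le> Suc (card T)" using 2(3) by (simp add: card_insert_le_m1 card_insert_if)
    then show ?thesis using ge2.IH(1)[OF 2(1,2)] by linarith
  qed
qed

section \<open>Weighted sums over good sets\<close>

definition good_poly :: "(nat set \<Rightarrow> int) \<Rightarrow> nat \<Rightarrow> int poly" where
  "good_poly b n =
     (\<Sum>S | S \<subseteq> {1..n} \<and> good S. smult (b S) (monom 1 (card S) * [:1, 1:] ^ (n - 2 * card S)))"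

lemma good_poly_0: "good_poly b 0 = [:b {}:]"
proof -
  have "{S. S \<subseteq> {1..0::nat} \<and> good S} = {{}}" by auto
  then show ?thesis by (simp add: good_poly_def)
qed

lemma good_poly_1: "good_poly b (Suc 0) = [:1, 1:] * [:b {}:]"
  unfolding good_poly_def good_sets_1 by simp

lemma finite_good_sets [simp]: "finite {S. S \<subseteq> {1..n::nat} \<and> good S}"
  by (rule finite_subset[of _ "Pow {1..n}"]) auto

text \<open>Sets without \<open>n + 2\<close> only gain one factor \<open>1 + x\<close>. Sets with
  \<open>n + 2\<close> gain a factor \<open>x\<close>, while their exponent of \<open>1 + x\<close>
  stays the same because \<open>n\<close> grows by 2 and the cardinality by 1.\<close>

lemma good_poly_Suc_Suc:
  "good_poly b (Suc (Suc n)) =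
     [:1, 1:] * good_poly b (Suc n) + [:0, 1:] * good_poly (\<lambda>S. b (insert (Suc (Suc n)) S)) n"
proof -
  let ?N = "Suc (Suc n)"
  let ?G = "\<lambda>n. {S. S \<subseteq> {1..n} \<and> good S}"
  let ?g = "\<lambda>n S. smult (b S) (monom 1 (card S) * [:1, 1:] ^ (n - 2 * card S))"
  have notin: "?N \<notin> S" if "S \<in> ?G n" for S using that by auto
  have inj: "inj_on (insert ?N) (?G n)"
    by (rule inj_onI) (metis notin insert_ident)
  have "good_poly b ?N = sum (?g ?N) (?G (Suc n) \<union> insert ?N ` ?G n)"
    unfolding good_poly_def good_sets_Suc_Suc ..
  also have "\<dots> = sum (?g ?N) (?G (Suc n)) + sum (?g ?N) (insert ?N ` ?G n)"
    by (rule sum.union_disjoint) auto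
  also have "sum (?g ?N) (?G (Suc n)) = [:1, 1:] * good_poly b (Suc n)"
    unfolding good_poly_def sum_distrib_left
  proof (rule sum.cong[OF refl])
    fix S assume "S \<in> ?G (Suc n)"
    then have "?N - 2 * card S = Suc (Suc n - 2 * card S)" using card_good[of S "Suc n"] by auto
    then show "?g ?N S = [:1, 1:] * ?g (Suc n) S"
      by (simp only: power_Suc mult_smult_right ac_simps)
  qed
  also have "sum (?g ?N) (insert ?N ` ?G n) = (\<Sum>S\<in>?G n. ?g ?N (insert ?N S))"
    using sum.reindex[OF inj] by simp
  also have "\<dots> = [:0, 1:] * good_poly (\<lambda>S. b (insert ?N S)) n"
    unfolding good_poly_def sum_distrib_left
  proof (rule sum.cong[OF refl])
    fix S assume S: "S \<in> ?G n"
    then have "finite S" using finite_subset by blast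
    then have c: "card (insert ?N S) = Suc (card S)" using notin[OF S] by simp
    show "?g ?N (insert ?N S) =
      [:0, 1:] * smult (b (insert ?N S)) (monom 1 (card S) * [:1, 1:] ^ (n - 2 * card S))"
      unfolding c by (simp add: monom_Suc)
  qed
  finally show ?thesis .
qed

lemma good_poly_add: "good_poly (\<lambda>S. b S + c S) n = good_poly b n + good_poly c n"
  by (simp add: good_poly_def smult_add_left sum.distrib)

lemma good_poly_sum: "good_poly (\<lambda>S. \<Sum>w\<in>A. b w S) n = (\<Sum>w\<in>A. good_poly (b w) n)"
  unfolding good_poly_def smult_sum by (rule sum.swap)

lemma good_poly_cong:
  "(\<And>S. S \<subseteq> {1..n} \<Longrightarrow> b S = c S) \<Longrightarrow> good_poly b n = good_poly c n"
  unfolding good_poly_def by (rule sum.cong) auto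

section \<open>Polynomial identities\<close>

definition gap_poly :: "nat \<Rightarrow> int poly" where
  "gap_poly n = (\<Sum>i\<in>{1..<n}. monom 1 i)"

lemma gap_poly_1: "gap_poly (Suc 0) = 0"
  by (simp add: gap_poly_def)

lemma gap_poly_Suc: "n \<ge> 1 \<Longrightarrow> gap_poly (Suc n) = [:0, 1:] * gap_poly n + [:0, 1:]"
proof (induction n rule: nat_induct_at_least)
  case base
  then show ?case by (simp add: gap_poly_def monom_altdef)
next
  case (Suc n)
  have *: "gap_poly (Suc k) = gap_poly k + monom 1 k" if "k \<ge> 1" for k
    using that by (simp add: gap_poly_def)
  show ?case unfolding *[of "Suc n", simplified] using Suc
    by (subst (2) *) (auto simp: algebra_simps monom_Suc)
qed

text \<open>The geometric sum with its denominator cleared; this is how \<open>gap_poly\<close>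
  arises from \<open>x^k - x\<close> in \<open>chow_fun_eq\<close>.\<close>

lemma mult_gap_poly: "n \<ge> 1 \<Longrightarrow> [:1, -1:] * gap_poly n = [:0, 1:] - monom 1 n"
proof (induction n rule: nat_induct_at_least)
  case base
  then show ?case by (simp add: gap_poly_def monom_altdef)
next
  case (Suc n)
  have "[:1, -1:] * gap_poly (Suc n) = [:0,1:] * ([:1, -1:] * gap_poly n) + [:0,1:] * [:1, -1:]"
    using Suc.hyps by (simp only: gap_poly_Suc distrib_left ac_simps)
  also have "\<dots> = [:0, 1:] - monom 1 (Suc n)"
    unfolding Suc.IH by (simp add: monom_Suc algebra_simps)
  finally show ?case .
qed

text \<open>The right-hand side of the third assumption is the difference of
  \<open>Q (s + 2) - x Q (s + 1)\<close> and \<open>Q (s + 1) - x Q s\<close>, so the plain sums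
  telescope. By \<open>gap_poly_Suc\<close>, each weighted sum is \<open>x\<close> times the
  previous weighted sum plus \<open>x\<close> times the previous plain sum.\<close>

lemma
  fixes \<Phi> Q :: "nat \<Rightarrow> int poly"
  assumes 0: "Q 0 = 0" "\<Phi> 0 = Q 1"
    and Suc: "\<And>s. s < n \<Longrightarrow> \<Phi> (Suc s) = Q (Suc (Suc s)) - [:1, 1:] * Q (Suc s) + [:0, 1:] * Q s"
  shows sum_second_difference: "(\<Sum>s\<le>n. \<Phi> s) = Q (Suc n) - [:0, 1:] * Q n"
    and sum_second_difference_gap_poly: "(\<Sum>s\<le>n. \<Phi> s * gap_poly (Suc n - s)) = [:0, 1:] * Q n"
proof -
  have x1: "[:1, 1:] = 1 + ([:0, 1:] :: int poly)" by (simp add: one_pCons)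
  have 1: "(\<Sum>s\<le>k. \<Phi> s) = Q (Suc k) - [:0, 1:] * Q k" if "k \<le> n" for k
    using that
  proof (induction k)
    case 0
    then show ?case using assms by simp
  next
    case (Suc k)
    then show ?case using assms(3)[of k] by (simp only: sum.atMost_Suc x1) (simp add: algebra_simps)
  qed
  have 2: "(\<Sum>s\<le>k. \<Phi> s * gap_poly (Suc k - s)) = [:0, 1:] * Q k" if "k \<le> n" for k
    using that
  proof (induction k)
    case 0
    then show ?case using assms by (simp add: gap_poly_1)
  next
    case (Suc k)
    \<comment> \<open>The last term drops out because \<open>gap_poly 1 = 0\<close>.\<close>
    have "(\<Sum>s\<le>Suc k. \<Phi> s * gap_poly (Suc (Suc k) - s)) =
        (\<Sum>s\<le>k. \<Phi> s * gap_poly (Suc (Suc k - s)))"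
      by (simp add: gap_poly_1 Suc_diff_le)
    also have "\<dots> = (\<Sum>s\<le>k. [:0, 1:] * (\<Phi> s * gap_poly (Suc k - s)) + [:0, 1:] * \<Phi> s)"
      by (rule sum.cong) (auto simp: gap_poly_Suc algebra_simps)
    also have "\<dots> = [:0, 1:] * ([:0, 1:] * Q k) + [:0, 1:] * (Q (Suc k) - [:0, 1:] * Q k)"
      unfolding sum.distrib sum_distrib_left[symmetric] using Suc 1[of k] by simp
    finally show ?case by (simp add: algebra_simps)
  qed
  show "(\<Sum>s\<le>n. \<Phi> s) = Q (Suc n) - [:0, 1:] * Q n" using 1 by simp
  show "(\<Sum>s\<le>n. \<Phi> s * gap_poly (Suc n - s)) = [:0, 1:] * Q n" using 2 by simp
qed

text \<open>The system is triangular: \<open>x^j p_j\<close> starts with \<open>x^j\<close>, so the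
  coefficient at \<open>x^i\<close> involves only \<open>c j\<close> with \<open>j \<le> i\<close>,
  and those with \<open>j < i\<close> vanish by induction.\<close>

lemma monom_mult_coeff_independent:
  fixes p :: "nat \<Rightarrow> 'b :: idom poly"
  assumes "\<And>i. i \<le> k \<Longrightarrow> coeff (p i) 0 = 1"
    and "(\<Sum>i\<le>k. smult (c i) (monom 1 i * p i)) = 0"
    and "i \<le> k"
  shows "c i = 0"
  using assms(3)
proof (induction i rule: less_induct)
  case (less i)
  have "0 = coeff (\<Sum>j\<le>k. smult (c j) (monom 1 j * p j)) i" using assms(2) by simp
  also have "\<dots> = (\<Sum>j\<le>k. if j = i then c i else 0)"
    unfolding coeff_sum
  proof (rule sum.cong[OF refl])
    fix j assume "j \<in> {..k}"
    then show "coeff (smult (c j) (monom 1 j * p j)) i = (if j = i then c i else 0)"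
      using less assms(1) by (cases j i rule: linorder_cases) (auto simp: coeff_monom_mult)
  qed
  finally show ?case using less.prems by simp
qed

section \<open>Incidence algebras\<close>

context finite_graded_bounded_poset
begin

abbreviation (input) inc :: "('a \<Rightarrow> 'a \<Rightarrow> 'c :: comm_ring_1) ring" where
  "inc \<equiv> incidence_algebra L"

section \<open>Ranks and the strict order\<close>

lemma lless_transitive:
  assumes "x \<in> carrier L" "y \<in> carrier L" "z \<in> carrier L"
  shows "x \<sqsubset> y \<Longrightarrow> y \<sqsubset> z \<Longrightarrow> x \<sqsubset> z"
  using assms le_trans[of x y z] le_antisym[of x y] unfolding lless_eq by auto

text \<open>The locale controls ranks only along covers. If \<open>t\<close> does not cover
  \<open>s\<close>, an element \<open>w\<close> between them splits the open interval into two
  smaller ones, as neither contains \<open>w\<close>.\<close>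

lemma rank_strict_mono:
  assumes "s \<in> carrier L" "t \<in> carrier L" "s \<sqsubset> t"
  shows "\<rho> s < \<rho> t"
  using assms
proof (induction "card {w \<in> carrier L. s \<sqsubset> w \<and> w \<sqsubset> t}" arbitrary: s t rule: less_induct)
  case less
  show ?case
  proof (cases "covers L t s")
    case True
    then show ?thesis using rank_covers by fastforce
  next
    case False
    then obtain w where w: "w \<in> carrier L" "s \<sqsubset> w" "w \<sqsubset> t"
      using less.prems unfolding covers_def by blast
    have irrefl: "\<not> w \<sqsubset> w" by (simp add: lless_eq)
    have "card {v \<in> carrier L. s \<sqsubset> v \<and> v \<sqsubset> w} < card {v \<in> carrier L. s \<sqsubset> v \<and> v \<sqsubset> t}"
      using w irrefl lless_transitive[of _ w t] lless_transitive[of s w] less.prems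
      by (intro psubset_card_mono psubsetI subsetI) (simp_all add: finite_carrier, blast+)
    moreover
    have "card {v \<in> carrier L. w \<sqsubset> v \<and> v \<sqsubset> t} < card {v \<in> carrier L. s \<sqsubset> v \<and> v \<sqsubset> t}"
      using w irrefl lless_transitive[of _ w t] lless_transitive[of s w] less.prems
      by (intro psubset_card_mono psubsetI subsetI) (simp_all add: finite_carrier, blast+)
    ultimately have "\<rho> s < \<rho> w" "\<rho> w < \<rho> t" using less w by blast+
    then show ?thesis by simp
  qed
qed

lemma bottom_lless: "t \<in> carrier L \<Longrightarrow> t \<noteq> \<bottom> \<Longrightarrow> \<bottom> \<sqsubset> t"
  by (simp add: lless_eq)

lemma rank_eq_0_iff: "t \<in> carrier L \<Longrightarrow> \<rho> t = 0 \<longleftrightarrow> t = \<bottom>"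
  using rank_strict_mono[of \<bottom> t] bottom_lless rank_bottom by fastforce

section \<open>Multiplication in the incidence algebra\<close>

lemma carrier_inc:
  "a \<in> carrier inc \<longleftrightarrow> (\<forall>s t. \<not> (s \<in> carrier L \<and> t \<in> carrier L \<and> s \<sqsubseteq> t) \<longrightarrow> a s t = 0)"
  by (simp add: incidence_algebra_def)

lemma incD: "a \<in> carrier inc \<Longrightarrow> \<not> (s \<in> carrier L \<and> t \<in> carrier L \<and> s \<sqsubseteq> t) \<Longrightarrow> a s t = 0"
  by (simp add: carrier_inc)

lemma one_inc: "\<one>\<^bsub>inc\<^esub> = (\<lambda>s t. if s \<in> carrier L \<and> s = t then 1 else 0)"
  by (simp add: incidence_algebra_def)

text \<open>Terms outside the interval vanish. Summing over the whole carrier makes the index set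
  independent of the endpoints, so that double sums can be swapped.\<close>

lemma mult_inc:
  assumes "a \<in> carrier inc" "b \<in> carrier inc"
  shows "(a \<otimes>\<^bsub>inc\<^esub> b) s t = (\<Sum>w\<in>carrier L. a s w * b w t)"
proof -
  have "(a \<otimes>\<^bsub>inc\<^esub> b) s t = (\<Sum>w\<in>\<lbrace>s..t\<rbrace>. a s w * b w t)"
    by (simp add: incidence_algebra_def)
  also have "\<dots> = (\<Sum>w\<in>carrier L. a s w * b w t)"
  proof (rule sum.mono_neutral_left)
    show "\<forall>w\<in>carrier L - \<lbrace>s..t\<rbrace>. a s w * b w t = 0"
    proof
      fix w assume "w \<in> carrier L - \<lbrace>s..t\<rbrace>"
      then have "\<not> s \<sqsubseteq> w \<or> \<not> w \<sqsubseteq> t" by blast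
      then have "a s w = 0 \<or> b w t = 0" using incD[OF assms(1)] incD[OF assms(2)] by blast
      then show "a s w * b w t = 0" by auto
    qed
  qed (auto simp: finite_carrier at_least_at_most_def)
  finally show ?thesis .
qed

lemma mult_inc_closed:
  assumes "a \<in> carrier inc" "b \<in> carrier inc"
  shows "a \<otimes>\<^bsub>inc\<^esub> b \<in> carrier inc"
  unfolding carrier_inc mult_inc[OF assms]
proof (intro allI impI sum.neutral ballI)
  fix s t w assume st: "\<not> (s \<in> carrier L \<and> t \<in> carrier L \<and> s \<sqsubseteq> t)" and w: "w \<in> carrier L"
  show "a s w * b w t = 0"
  proof (cases "s \<in> carrier L \<and> s \<sqsubseteq> w")
    case True
    then have "\<not> (w \<in> carrier L \<and> t \<in> carrier L \<and> w \<sqsubseteq> t)" using st w le_trans by blast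
    then show ?thesis using incD[OF assms(2)] by simp
  next
    case False
    then show ?thesis using incD[OF assms(1)] by simp
  qed
qed

lemma monoid_inc: "monoid (inc :: ('a \<Rightarrow> 'a \<Rightarrow> 'c :: comm_ring_1) ring)"
proof
  show one: "\<one>\<^bsub>inc\<^esub> \<in> carrier (inc :: ('a \<Rightarrow> 'a \<Rightarrow> 'c) ring)"
    by (auto simp: carrier_inc one_inc)
  fix a b c :: "'a \<Rightarrow> 'a \<Rightarrow> 'c"
  assume abc: "a \<in> carrier inc" "b \<in> carrier inc"
  show "a \<otimes>\<^bsub>inc\<^esub> b \<in> carrier inc" by (rule mult_inc_closed[OF abc])
  show "a \<otimes>\<^bsub>inc\<^esub> b \<otimes>\<^bsub>inc\<^esub> c = a \<otimes>\<^bsub>inc\<^esub> (b \<otimes>\<^bsub>inc\<^esub> c)" if c: "c \<in> carrier inc"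
  proof (intro ext)
    fix s t
    have "(a \<otimes>\<^bsub>inc\<^esub> b \<otimes>\<^bsub>inc\<^esub> c) s t = (\<Sum>w\<in>carrier L. \<Sum>v\<in>carrier L. a s v * b v w * c w t)"
      using abc c by (simp add: mult_inc mult_inc_closed sum_distrib_right)
    also have "\<dots> = (\<Sum>v\<in>carrier L. \<Sum>w\<in>carrier L. a s v * b v w * c w t)"
      by (rule sum.swap)
    also have "\<dots> = (a \<otimes>\<^bsub>inc\<^esub> (b \<otimes>\<^bsub>inc\<^esub> c)) s t"
      using abc c by (simp add: mult_inc mult_inc_closed sum_distrib_left mult.assoc)
    finally show "(a \<otimes>\<^bsub>inc\<^esub> b \<otimes>\<^bsub>inc\<^esub> c) s t = (a \<otimes>\<^bsub>inc\<^esub> (b \<otimes>\<^bsub>inc\<^esub> c)) s t" .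
  qed
  show "\<one>\<^bsub>inc\<^esub> \<otimes>\<^bsub>inc\<^esub> a = a"
  proof (intro ext)
    fix s t
    have "(\<one>\<^bsub>inc\<^esub> \<otimes>\<^bsub>inc\<^esub> a) s t = (\<Sum>w\<in>carrier L. if w = s then a s t else 0)"
      unfolding mult_inc[OF one abc(1)] by (rule sum.cong) (auto simp: one_inc)
    then show "(\<one>\<^bsub>inc\<^esub> \<otimes>\<^bsub>inc\<^esub> a) s t = a s t"
      using incD[OF abc(1)] by (auto simp: finite_carrier)
  qed
  show "a \<otimes>\<^bsub>inc\<^esub> \<one>\<^bsub>inc\<^esub> = a"
  proof (intro ext)
    fix s t
    have "(a \<otimes>\<^bsub>inc\<^esub> \<one>\<^bsub>inc\<^esub>) s t = (\<Sum>w\<in>carrier L. if w = t then a s t else 0)"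
      unfolding mult_inc[OF abc(1) one] by (rule sum.cong) (auto simp: one_inc)
    then show "(a \<otimes>\<^bsub>inc\<^esub> \<one>\<^bsub>inc\<^esub>) s t = a s t"
      using incD[OF abc(1)] by (auto simp: finite_carrier)
  qed
qed

section \<open>Invertibility for a constant diagonal\<close>

lemma sum_split_top:
  fixes g :: "'a \<Rightarrow> 'c :: comm_monoid_add"
  assumes "t \<in> carrier L" "\<And>w. w \<in> carrier L \<Longrightarrow> \<not> w \<sqsubseteq> t \<Longrightarrow> g w = 0"
  shows "(\<Sum>w\<in>carrier L. g w) = g t + (\<Sum>w | w \<in> carrier L \<and> w \<sqsubset> t. g w)"
proof -
  have "(\<Sum>w\<in>carrier L. g w) = (\<Sum>w\<in>insert t {w \<in> carrier L. w \<sqsubset> t}. g w)"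
    using assms by (intro sum.mono_neutral_right) (auto simp: finite_carrier lless_eq)
  then show ?thesis by (simp add: finite_carrier lless_eq)
qed

text \<open>Isolating the term \<open>w = t\<close> in \<open>b a = 1\<close> and multiplying by
  \<open>u\<close>, which is its own inverse, gives a recursion for \<open>b s t\<close> over the
  rank of \<open>t\<close>.\<close>

lemma ex_left_inverse:
  fixes u :: "'c :: comm_ring_1"
  assumes a: "a \<in> carrier inc" "\<And>t. t \<in> carrier L \<Longrightarrow> a t t = u" and u: "u * u = 1"
  shows "\<exists>b\<in>carrier inc. b \<otimes>\<^bsub>inc\<^esub> a = \<one>\<^bsub>inc\<^esub> \<and> (\<forall>t\<in>carrier L. b t t = u)"
proof -
  \<comment> \<open>\<open>f t\<close> stands for the column of \<open>b\<close> at
    \<open>t\<close>, as a function of \<open>s\<close>; thus the recursion runs over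
    \<open>t\<close> alone.\<close>
  define P where "P f t r \<longleftrightarrow> r = (\<lambda>s. if s \<in> carrier L \<and> t \<in> carrier L \<and> s \<sqsubseteq> t
    then u * ((if s = t then 1 else 0) - (\<Sum>w | w \<in> carrier L \<and> w \<sqsubset> t. f w s * a w t)) else 0)"
    for f :: "'a \<Rightarrow> 'a \<Rightarrow> 'c" and t r
  have "\<exists>f. \<forall>t. P f t (f t)"
  proof (rule dependent_wf_choice[where P = P, OF wf_measure[of \<rho>]])
    fix f g :: "'a \<Rightarrow> 'a \<Rightarrow> 'c" and t r
    assume "\<And>z. (z, t) \<in> measure \<rho> \<Longrightarrow> f z = g z"
    then have "f w = g w" if "w \<in> carrier L" "w \<sqsubset> t" "t \<in> carrier L" for w
      using that rank_strict_mono by simp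
    then have "(\<Sum>w | w \<in> carrier L \<and> w \<sqsubset> t. f w s * a w t) =
        (\<Sum>w | w \<in> carrier L \<and> w \<sqsubset> t. g w s * a w t)" if "t \<in> carrier L" for s
      using that by (intro sum.cong) simp_all
    then show "P f t r = P g t r"
      unfolding P_def by (cases "t \<in> carrier L") (simp_all cong: if_cong)
  next
    show "\<exists>r. P f t r" for f t unfolding P_def by (rule exI, rule HOL.refl)
  qed
  then obtain f where f: "\<And>t. P f t (f t)" by blast
  define b where "b s t = f t s" for s t
  have b_rec: "b s t = (if s \<in> carrier L \<and> t \<in> carrier L \<and> s \<sqsubseteq> t
    then u * ((if s = t then 1 else 0) - (\<Sum>w | w \<in> carrier L \<and> w \<sqsubset> t. b s w * a w t)) else 0)"
    for s t
    using f[of t] unfolding P_def b_def by (rule fun_cong)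
  have b: "b \<in> carrier inc" unfolding carrier_inc by (subst b_rec) auto
  have "b \<otimes>\<^bsub>inc\<^esub> a = \<one>\<^bsub>inc\<^esub>"
  proof (intro ext)
    fix s t
    show "(b \<otimes>\<^bsub>inc\<^esub> a) s t = \<one>\<^bsub>inc\<^esub> s t"
    proof (cases "s \<in> carrier L \<and> t \<in> carrier L \<and> s \<sqsubseteq> t")
      case False
      then show ?thesis using incD[OF mult_inc_closed[OF b a(1)] False] by (auto simp: one_inc)
    next
      case True
      have "(b \<otimes>\<^bsub>inc\<^esub> a) s t = b s t * u + (\<Sum>w | w \<in> carrier L \<and> w \<sqsubset> t. b s w * a w t)"
        unfolding mult_inc[OF b a(1)] using True incD[OF a(1)] a(2)
        by (subst sum_split_top[of t]) auto
      also have "\<dots> = u * u * (if s = t then 1 else 0)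
          + (1 - u * u) * (\<Sum>w | w \<in> carrier L \<and> w \<sqsubset> t. b s w * a w t)"
        using True by (subst b_rec) (simp add: algebra_simps)
      finally show ?thesis using u True by (simp add: one_inc)
    qed
  qed
  moreover have "b t t = u" if t: "t \<in> carrier L" for t
  proof -
    \<comment> \<open>On the diagonal the recursive sum is empty of nonzero terms, since
      \<open>t \<sqsubseteq> w \<sqsubset> t\<close> is impossible.\<close>
    have "b t w = 0" if "w \<in> carrier L" "w \<sqsubset> t" for w
      using incD[OF b, of t w] le_antisym[of t w] t that by (auto simp: lless_eq)
    then show ?thesis using t by (subst b_rec) simp
  qed
  ultimately show ?thesis using b by blast
qed

text \<open>The left inverse \<open>b\<close> has the same diagonal and hence a left inverse
  \<open>c\<close> of its own. Then \<open>c = c (b a) = (c b) a = a\<close>, so \<open>b\<close> is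
  two-sided.\<close>

lemma Units_inc:
  fixes u :: "'c :: comm_ring_1"
  assumes a: "a \<in> carrier inc" "\<And>t. t \<in> carrier L \<Longrightarrow> a t t = u" and u: "u * u = 1"
  shows "a \<in> Units inc"
proof -
  interpret I: monoid "inc :: ('a \<Rightarrow> 'a \<Rightarrow> 'c) ring" by (rule monoid_inc)
  obtain b where b: "b \<in> carrier inc" "b \<otimes>\<^bsub>inc\<^esub> a = \<one>\<^bsub>inc\<^esub>" "\<forall>t\<in>carrier L. b t t = u"
    using ex_left_inverse[OF assms] by blast
  obtain c where c: "c \<in> carrier inc" "c \<otimes>\<^bsub>inc\<^esub> b = \<one>\<^bsub>inc\<^esub>"
    using ex_left_inverse[of b u] b u by blast
  have "c = a" using I.inv_unique[OF c(2) b(2)] a b c 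
    by (metis I.m_assoc I.l_one I.r_one)
  then show ?thesis using a b c unfolding Units_def by blast
qed

section \<open>The Chow function\<close>

lemma zeta_in_Units: "zeta L \<in> Units inc"
  by (rule Units_inc[where u = 1]) (auto simp: carrier_inc zeta_def)

lemma moebius_carrier: "moebius L \<in> carrier inc"
  using monoid.Units_inv_closed[OF monoid_inc zeta_in_Units] by (simp add: moebius_def)

lemma zeta_moebius: "zeta L \<otimes>\<^bsub>inc\<^esub> moebius L = \<one>\<^bsub>inc\<^esub>"
  using monoid.Units_r_inv[OF monoid_inc zeta_in_Units] by (simp add: moebius_def)

lemma moebius_zeta: "moebius L \<otimes>\<^bsub>inc\<^esub> zeta L = \<one>\<^bsub>inc\<^esub>"
  using monoid.Units_l_inv[OF monoid_inc zeta_in_Units] by (simp add: moebius_def)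

text \<open>Embeds the integer-valued incidence algebra, so that zeta and Moebius functions can be
  multiplied with polynomial-valued ones.\<close>

definition const_inc :: "('a \<Rightarrow> 'a \<Rightarrow> int) \<Rightarrow> 'a \<Rightarrow> 'a \<Rightarrow> int poly" where
  "const_inc a s t = [:a s t:]"

lemma const_inc_carrier: "a \<in> carrier inc \<Longrightarrow> const_inc a \<in> carrier inc"
  by (simp add: carrier_inc const_inc_def)

lemma const_inc_mult:
  assumes "a \<in> carrier inc" "b \<in> carrier inc"
  shows "const_inc a \<otimes>\<^bsub>inc\<^esub> const_inc b = const_inc (a \<otimes>\<^bsub>inc\<^esub> b)"
proof -
  have "(\<Sum>w\<in>A. [:g w:]) = [:\<Sum>w\<in>A. g w:]" for A and g :: "'a \<Rightarrow> int"
    by (induction A rule: infinite_finite_induct) simp_all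
  then show ?thesis using assms
    by (intro ext) (simp add: mult_inc const_inc_carrier, simp add: const_inc_def mult_inc mult.commute)
qed

lemma const_inc_one: "const_inc \<one>\<^bsub>inc\<^esub> = \<one>\<^bsub>inc\<^esub>"
  by (intro ext) (auto simp: const_inc_def one_inc one_pCons)

text \<open>The reversal of the zeta function with respect to rank.\<close>

definition rank_monom :: "'a \<Rightarrow> 'a \<Rightarrow> int poly" where
  "rank_monom s t =
     (if s \<in> carrier L \<and> t \<in> carrier L \<and> s \<sqsubseteq> t then monom 1 (\<rho> t - \<rho> s) else 0)"

lemma rank_monom_carrier: "rank_monom \<in> carrier inc"
  by (simp add: carrier_inc rank_monom_def)

text \<open>In this product form, multiplying by zeta on the left turns the characteristic function
  into \<open>rank_monom\<close>.\<close>

lemma char_fun_eq: "char_fun L \<rho> = const_inc (moebius L) \<otimes>\<^bsub>inc\<^esub> rank_monom"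
proof (intro ext)
  fix s t
  have "(const_inc (moebius L) \<otimes>\<^bsub>inc\<^esub> rank_monom) s t =
      (\<Sum>w\<in>\<lbrace>s..t\<rbrace>. [:moebius L s w:] * rank_monom w t)"
    by (simp add: incidence_algebra_def const_inc_def)
  also have "\<dots> = (if s \<in> carrier L \<and> t \<in> carrier L \<and> s \<sqsubseteq> t
      then \<Sum>w\<in>\<lbrace>s..t\<rbrace>. monom (moebius L s w) (\<rho> t - \<rho> w) else 0)"
  proof (cases "s \<in> carrier L \<and> t \<in> carrier L \<and> s \<sqsubseteq> t")
    case True
    then show ?thesis
      by (auto simp: rank_monom_def at_least_at_most_def smult_monom intro!: sum.cong)
  next
    case False
    have "moebius L s w = 0 \<or> rank_monom w t = 0" for w
      using incD[OF moebius_carrier, of s w] incD[OF rank_monom_carrier, of w t] False le_trans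
      by blast
    then have "[:moebius L s w:] * rank_monom w t = 0" for w by auto
    then show ?thesis using False by (auto intro!: sum.neutral)
  qed
  finally show "char_fun L \<rho> s t = (const_inc (moebius L) \<otimes>\<^bsub>inc\<^esub> rank_monom) s t"
    by (simp add: char_fun_def)
qed

lemma char_fun_carrier: "char_fun L \<rho> \<in> carrier inc"
  by (simp add: char_fun_def carrier_inc)

lemma char_fun_diag:
  assumes "t \<in> carrier L"
  shows "char_fun L \<rho> t t = 1"
proof -
  have *: "\<lbrace>t..t\<rbrace> = {t}" using assms by (auto simp: at_least_at_most_def)
  have "1 = (zeta L \<otimes>\<^bsub>inc\<^esub> moebius L) t t"
    using assms unfolding zeta_moebius by (simp add: one_inc)
  also have "\<dots> = moebius L t t" using assms * by (simp add: incidence_algebra_def zeta_def)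
  finally show ?thesis using assms * by (simp add: char_fun_def)
qed

text \<open>At \<open>x = 1\<close> the characteristic function becomes the product of Moebius and
  zeta, which vanishes off the diagonal.\<close>

lemma dvd_char_fun:
  assumes "s \<noteq> t"
  shows "[:-1, 1:] dvd char_fun L \<rho> s t"
proof -
  have "poly (char_fun L \<rho> s t) 1 = (moebius L \<otimes>\<^bsub>inc\<^esub> zeta L) s t"
  proof (cases "s \<in> carrier L \<and> t \<in> carrier L \<and> s \<sqsubseteq> t")
    case True
    then show ?thesis
      by (auto simp: char_fun_def incidence_algebra_def poly_sum poly_monom zeta_def
          at_least_at_most_def intro!: sum.cong)
  next
    case False
    moreover have "\<one>\<^bsub>inc\<^esub> s t = (0 :: int)" using assms by (simp add: one_inc)
    ultimately show ?thesis unfolding moebius_zeta by (auto simp: char_fun_def)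
  qed
  also have "\<dots> = 0" unfolding moebius_zeta using assms by (simp add: one_inc)
  finally show ?thesis by (simp add: poly_eq_0_iff_dvd)
qed

text \<open>The term \<open>x\<close> times the identity accounts for the diagonal convention
  \<open>-1\<close>, since \<open>(x - 1) (-1) = 1 - x\<close>. One formula thus covers all pairs
  and avoids \<open>div\<close>.\<close>

lemma mult_reduced_char_fun:
  "[:-1, 1:] * reduced_char_fun L \<rho> s t = char_fun L \<rho> s t - [:0, 1:] * \<one>\<^bsub>inc\<^esub> s t"
proof (cases "s = t")
  case True
  then show ?thesis
    using incD[OF char_fun_carrier, of t t]
    by (cases "t \<in> carrier L") (simp_all add: reduced_char_fun_def char_fun_diag one_inc one_pCons)
next
  case False
  have "[:-1, 1:] * reduced_char_fun L \<rho> s t = char_fun L \<rho> s t"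
    unfolding reduced_char_fun_def using False dvd_mult_div_cancel[OF dvd_char_fun[OF False]]
    by (simp only: simp_thms if_False)
  then show ?thesis using False by (simp add: one_inc)
qed

lemma reduced_char_fun_in_Units: "reduced_char_fun L \<rho> \<in> Units inc"
  by (rule Units_inc[where u = "-1"]) (auto simp: carrier_inc reduced_char_fun_def char_fun_def)

text \<open>The function \<open>f\<close> is the row of \<open>F = (1 - M)\<^sup>-\<^sup>1\<close> at the bottom element.\<close>

lemma chow_fun_eq:
  fixes f :: "'a \<Rightarrow> int poly"
  assumes bot: "f \<bottom> = 1"
    and rec: "\<And>t. t \<in> carrier L \<Longrightarrow> t \<noteq> \<bottom> \<Longrightarrow>
      f t = (\<Sum>w | w \<in> carrier L \<and> w \<sqsubset> t. f w * gap_poly (\<rho> t - \<rho> w))"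
    and t: "t \<in> carrier L"
  shows "chow_fun L \<rho> \<bottom> t = f t + (\<Sum>w | w \<in> carrier L \<and> w \<sqsubset> t. f w)"
proof -
  interpret I: monoid "inc :: ('a \<Rightarrow> 'a \<Rightarrow> int poly) ring" by (rule monoid_inc)
  \<comment> \<open>Only the row at \<open>\<bottom>\<close> is filled in; the other rows are zero
    and stay zero under right multiplication.\<close>
  define F where "F = (\<lambda>s t. if s = \<bottom> \<and> t \<in> carrier L then f t else 0)"
  define Z where "Z = const_inc (zeta L)"
  define h where "h = F \<otimes>\<^bsub>inc\<^esub> Z"
  let ?R = "reduced_char_fun L \<rho>"
  have zc: "zeta L \<in> carrier inc" by (simp add: carrier_inc zeta_def)
  have F: "F \<in> carrier inc" by (auto simp: carrier_inc F_def)
  have Z: "Z \<in> carrier inc" unfolding Z_def by (rule const_inc_carrier[OF zc])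
  have h: "h \<in> carrier inc" unfolding h_def by (rule I.m_closed[OF F Z])
  have R: "?R \<in> carrier inc" using reduced_char_fun_in_Units by (rule I.Units_closed)
  have M: "const_inc (moebius L) \<in> carrier inc" by (rule const_inc_carrier[OF moebius_carrier])
  have "Z \<otimes>\<^bsub>inc\<^esub> char_fun L \<rho> = rank_monom"
    unfolding char_fun_eq Z_def I.m_assoc[OF const_inc_carrier[OF zc] M rank_monom_carrier, symmetric]
      const_inc_mult[OF zc moebius_carrier] zeta_moebius const_inc_one
    by (rule I.l_one[OF rank_monom_carrier])
  then have hchar: "h \<otimes>\<^bsub>inc\<^esub> char_fun L \<rho> = F \<otimes>\<^bsub>inc\<^esub> rank_monom"
    unfolding h_def using I.m_assoc[OF F Z char_fun_carrier] by simp
  \<comment> \<open>Thus \<open>h\<close> times the reduced characteristic function is minus the row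
    of the identity at \<open>\<bottom>\<close>.\<close>
  have hR: "(h \<otimes>\<^bsub>inc\<^esub> ?R) s v = (if s = \<bottom> \<and> v = \<bottom> then -1 else 0)" for s v
  proof (cases "s = \<bottom> \<and> v \<in> carrier L")
    case False
    have "(h \<otimes>\<^bsub>inc\<^esub> ?R) s v = 0"
    proof (cases "v \<in> carrier L")
      case True
      then have "h s w = 0" for w
        unfolding h_def mult_inc[OF F Z] using False by (simp add: F_def)
      then show ?thesis by (simp add: mult_inc[OF h R])
    next
      case v: False
      then show ?thesis using incD[OF I.m_closed[OF h R]] by blast
    qed
    then show ?thesis using False by auto
  next
    case True
    \<comment> \<open>The factor \<open>x - 1\<close> clears the division and is cancelled at the
      end. It leaves \<open>F\<close> times \<open>rank_monom - x Z\<close>, whose diagonal entries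
      are \<open>1 - x\<close> and whose entries on strict pairs are \<open>(x - 1)\<close> times a
      \<open>gap_poly\<close>.\<close>
    have "[:-1, 1:] * (h \<otimes>\<^bsub>inc\<^esub> ?R) s v = (\<Sum>w\<in>carrier L. h s w * ([:-1, 1:] * ?R w v))"
      unfolding mult_inc[OF h R] sum_distrib_left by (simp only: ac_simps)
    also have "\<dots> = (h \<otimes>\<^bsub>inc\<^esub> char_fun L \<rho>) s v - [:0, 1:] * (h \<otimes>\<^bsub>inc\<^esub> \<one>\<^bsub>inc\<^esub>) s v"
      unfolding mult_reduced_char_fun mult_inc[OF h char_fun_carrier] mult_inc[OF h I.one_closed]
        right_diff_distrib sum_subtractf sum_distrib_left by (simp only: ac_simps)
    also have "\<dots> = (F \<otimes>\<^bsub>inc\<^esub> rank_monom) s v - [:0, 1:] * (F \<otimes>\<^bsub>inc\<^esub> Z) s v"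
      unfolding hchar I.r_one[OF h] by (simp add: h_def)
    also have "\<dots> = (\<Sum>w\<in>carrier L. F s w * (rank_monom w v - [:0, 1:] * Z w v))"
      unfolding mult_inc[OF F rank_monom_carrier] mult_inc[OF F Z]
        right_diff_distrib sum_subtractf sum_distrib_left by (simp only: ac_simps)
    also have "\<dots> = F s v * (rank_monom v v - [:0, 1:] * Z v v)
        + (\<Sum>w | w \<in> carrier L \<and> w \<sqsubset> v. F s w * (rank_monom w v - [:0, 1:] * Z w v))"
      using True by (intro sum_split_top) (auto simp: incD[OF Z] incD[OF rank_monom_carrier])
    also have "F s v * (rank_monom v v - [:0, 1:] * Z v v) = [:1, -1:] * f v"
      using True by (simp add: F_def rank_monom_def Z_def const_inc_def zeta_def one_pCons)
    also have "(\<Sum>w | w \<in> carrier L \<and> w \<sqsubset> v. F s w * (rank_monom w v - [:0, 1:] * Z w v)) =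
        (\<Sum>w | w \<in> carrier L \<and> w \<sqsubset> v. [:-1, 1:] * (f w * gap_poly (\<rho> v - \<rho> w)))"
    proof (rule sum.cong[OF HOL.refl])
      fix w assume w: "w \<in> {w \<in> carrier L. w \<sqsubset> v}"
      then have "\<rho> w < \<rho> v" "w \<sqsubseteq> v" using True rank_strict_mono by (auto simp: lless_eq)
      then have "rank_monom w v - [:0, 1:] * Z w v = - ([:1, -1:] * gap_poly (\<rho> v - \<rho> w))"
        using w True mult_gap_poly[of "\<rho> v - \<rho> w"]
        by (simp add: rank_monom_def Z_def const_inc_def zeta_def)
      also have "\<dots> = [:-1, 1:] * gap_poly (\<rho> v - \<rho> w)" by simp
      finally have *: "rank_monom w v - [:0, 1:] * Z w v = [:-1, 1:] * gap_poly (\<rho> v - \<rho> w)" .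
      have Fw: "F s w = f w" using w True by (simp add: F_def)
      show "F s w * (rank_monom w v - [:0, 1:] * Z w v) = [:-1, 1:] * (f w * gap_poly (\<rho> v - \<rho> w))"
        unfolding * Fw by (rule mult.left_commute)
    qed
    also have "[:1, -1:] * f v + \<dots> =
        [:-1, 1:] * ((\<Sum>w | w \<in> carrier L \<and> w \<sqsubset> v. f w * gap_poly (\<rho> v - \<rho> w)) - f v)"
      unfolding sum_distrib_left[symmetric] by (simp add: algebra_simps)
    also have "(\<Sum>w | w \<in> carrier L \<and> w \<sqsubset> v. f w * gap_poly (\<rho> v - \<rho> w)) - f v =
        (if s = \<bottom> \<and> v = \<bottom> then -1 else 0)"
    proof (cases "v = \<bottom>")
      case v: True
      then have "{w \<in> carrier L. w \<sqsubset> v} = {}" using rank_strict_mono[of _ \<bottom>] rank_bottom by auto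
      then show ?thesis using v True bot by (simp only: sum.empty) simp
    qed (use True rec in simp)
    finally show ?thesis by (rule mult_left_cancel[THEN iffD1, rotated]) simp
  qed
  \<comment> \<open>Multiplying \<open>hR\<close> by the inverse from the right leaves, in the row
    at \<open>\<bottom>\<close>, minus that row of the inverse: the Chow function.\<close>
  have "h = h \<otimes>\<^bsub>inc\<^esub> ?R \<otimes>\<^bsub>inc\<^esub> inv\<^bsub>inc\<^esub> ?R"
    using I.m_assoc[OF h R I.Units_inv_closed[OF reduced_char_fun_in_Units]]
      I.Units_r_inv[OF reduced_char_fun_in_Units] I.r_one[OF h] by simp
  then have "h \<bottom> t = (h \<otimes>\<^bsub>inc\<^esub> ?R \<otimes>\<^bsub>inc\<^esub> inv\<^bsub>inc\<^esub> ?R) \<bottom> t" by simp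
  also have "\<dots> = (\<Sum>w\<in>carrier L. if w = \<bottom> then - (inv\<^bsub>inc\<^esub> ?R) \<bottom> t else 0)"
    unfolding mult_inc[OF I.m_closed[OF h R] I.Units_inv_closed[OF reduced_char_fun_in_Units]] hR
    by (rule sum.cong) auto
  also have "\<dots> = chow_fun L \<rho> \<bottom> t" by (simp add: finite_carrier chow_fun_def)
  finally have "chow_fun L \<rho> \<bottom> t = h \<bottom> t" ..
  also have "\<dots> = (\<Sum>w\<in>carrier L. F \<bottom> w * Z w t)" unfolding h_def mult_inc[OF F Z] ..
  also have "\<dots> = F \<bottom> t * Z t t + (\<Sum>w | w \<in> carrier L \<and> w \<sqsubset> t. F \<bottom> w * Z w t)"
    using t by (intro sum_split_top) (auto simp: incD[OF Z])
  also have "\<dots> = f t + (\<Sum>w | w \<in> carrier L \<and> w \<sqsubset> t. f w)"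
    using t by (intro arg_cong2[of _ _ _ _ "(+)"] sum.cong)
      (auto simp: F_def Z_def const_inc_def zeta_def lless_eq one_pCons)
  finally show ?thesis .
qed

section \<open>Flag vectors of lower intervals\<close>

text \<open>The nested comprehension has the shape that \<open>sum.group\<close> produces.\<close>

abbreviation (input) level :: "'a \<Rightarrow> nat \<Rightarrow> 'a set" where
  "level t s \<equiv> {w. w \<in> {w \<in> carrier L. w \<sqsubset> t} \<and> \<rho> w = s}"

definition lower_chains :: "'a \<Rightarrow> nat set \<Rightarrow> 'a set set" where
  "lower_chains t S =
     {C. C \<subseteq> {w \<in> carrier L. w \<sqsubset> t} \<and> Complete_Partial_Order.chain (\<sqsubseteq>) C \<and> \<rho> ` C = S}"

definition lower_flag_h :: "'a \<Rightarrow> nat set \<Rightarrow> int" where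
  "lower_flag_h t S = (\<Sum>T\<in>Pow S. (-1) ^ (card S - card T) * int (card (lower_chains t T)))"

lemma finite_lower_chains: "finite (lower_chains t S)"
  by (rule finite_subset[of _ "Pow (carrier L)"]) (auto simp: lower_chains_def finite_carrier)

lemma lower_chains_empty: "lower_chains t {} = {{}}"
  by (auto simp: lower_chains_def Complete_Partial_Order.chain_def)

lemma lower_chains_insert:
  assumes t: "t \<in> carrier L" and T: "T \<subseteq> {..<s}"
  shows "lower_chains t (insert s T) = (\<Union>w\<in>level t s. insert w ` lower_chains w T)"
proof
  show "lower_chains t (insert s T) \<subseteq> (\<Union>w\<in>level t s. insert w ` lower_chains w T)"
  proof
    fix C assume "C \<in> lower_chains t (insert s T)"
    then have C: "C \<subseteq> {w \<in> carrier L. w \<sqsubset> t}" "Complete_Partial_Order.chain (\<sqsubseteq>) C"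
      "\<rho> ` C = insert s T" by (auto simp: lower_chains_def)
    then obtain w where w: "w \<in> C" "\<rho> w = s" by (metis imageE insertI1)
    have less: "v \<sqsubset> w" if v: "v \<in> C - {w}" for v
    proof (rule ccontr)
      assume "\<not> v \<sqsubset> w"
      then have "w \<sqsubset> v" using C(2) v w by (auto simp: Complete_Partial_Order.chain_def lless_eq)
      then have "s < \<rho> v" using rank_strict_mono C(1) v w by blast
      moreover have "\<rho> v \<in> insert s T" using C(3) v by blast
      ultimately show False using T by auto
    qed
    have rank_less: "\<rho> v < s" if "v \<in> C - {w}" for v
      using rank_strict_mono[OF _ _ less[OF that]] C(1) w that by blast
    have "\<rho> ` (C - {w}) = T"
    proof
      show "\<rho> ` (C - {w}) \<subseteq> T"
      proof (rule image_subsetI)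
        fix v assume v: "v \<in> C - {w}"
        then have "\<rho> v \<in> insert s T" using C(3) by blast
        then show "\<rho> v \<in> T" using rank_less[OF v] by simp
      qed
      show "T \<subseteq> \<rho> ` (C - {w})"
      proof
        fix i assume "i \<in> T"
        then have "i \<in> \<rho> ` C" "i < s" using C(3) T by auto
        then show "i \<in> \<rho> ` (C - {w})" using w(2) by auto
      qed
    qed
    moreover have "C - {w} \<subseteq> {v \<in> carrier L. v \<sqsubset> w}" using less C(1) by blast
    moreover have "Complete_Partial_Order.chain (\<sqsubseteq>) (C - {w})"
      using C(2) by (rule chain_subset) blast
    ultimately have "C - {w} \<in> lower_chains w T" by (simp add: lower_chains_def)
    moreover have "C = insert w (C - {w})" "w \<in> level t s" using w C(1) by auto
    ultimately show "C \<in> (\<Union>w\<in>level t s. insert w ` lower_chains w T)" by blast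
  qed
  show "(\<Union>w\<in>level t s. insert w ` lower_chains w T) \<subseteq> lower_chains t (insert s T)"
  proof
    fix D assume "D \<in> (\<Union>w\<in>level t s. insert w ` lower_chains w T)"
    then obtain w C where w: "w \<in> carrier L" "w \<sqsubset> t" "\<rho> w = s" and D: "D = insert w C"
      and C: "C \<subseteq> {v \<in> carrier L. v \<sqsubset> w}" "Complete_Partial_Order.chain (\<sqsubseteq>) C" "\<rho> ` C = T"
      by (auto simp: lower_chains_def)
    have "v \<sqsubset> t" if "v \<in> C" for v using C(1) that w t lless_transitive[of v w t] by blast
    then have "D \<subseteq> {v \<in> carrier L. v \<sqsubset> t}" using w C(1) D by blast
    moreover have "Complete_Partial_Order.chain (\<sqsubseteq>) D"
      using C(1,2) w(1) unfolding D by (auto simp: Complete_Partial_Order.chain_def lless_eq)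
    moreover have "\<rho> ` D = insert s T" using D C(3) w(3) by simp
    ultimately show "D \<in> lower_chains t (insert s T)" by (simp add: lower_chains_def)
  qed
qed

lemma card_lower_chains_insert:
  assumes t: "t \<in> carrier L" and T: "T \<subseteq> {..<s}"
  shows "card (lower_chains t (insert s T)) = (\<Sum>w\<in>level t s. card (lower_chains w T))"
proof -
  have fin: "finite (level t s)" by (simp add: finite_carrier)
  have "card (lower_chains t (insert s T)) = (\<Sum>w\<in>level t s. card (insert w ` lower_chains w T))"
    unfolding lower_chains_insert[OF assms]
  proof (rule card_UN_disjoint[OF fin])
    show "\<forall>w\<in>level t s. \<forall>v\<in>level t s. w \<noteq> v \<longrightarrow>
        insert w ` lower_chains w T \<inter> insert v ` lower_chains v T = {}"
    proof (intro ballI impI, rule ccontr)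
      fix w v assume wv: "w \<in> level t s" "v \<in> level t s" "w \<noteq> v"
        and "insert w ` lower_chains w T \<inter> insert v ` lower_chains v T \<noteq> {}"
      then obtain C D where "C \<in> lower_chains w T" "D \<in> lower_chains v T" "insert w C = insert v D"
        by blast
      then have "w \<in> D" "\<rho> ` D = T" using wv by (auto simp: lower_chains_def)
      then have "\<rho> w \<in> T" by blast
      then show False using wv T by auto
    qed
  qed (simp add: finite_lower_chains)
  also have "\<dots> = (\<Sum>w\<in>level t s. card (lower_chains w T))"
  proof (rule sum.cong[OF HOL.refl])
    fix w
    have "w \<notin> C" if "C \<in> lower_chains w T" for C
      using that by (auto simp: lower_chains_def lless_eq)
    then show "card (insert w ` lower_chains w T) = card (lower_chains w T)"
      by (intro card_image inj_onI) (metis insert_ident)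
  qed
  finally show ?thesis .
qed

lemma lower_flag_h_empty: "lower_flag_h t {} = 1"
  by (simp add: lower_flag_h_def lower_chains_empty)

lemma lower_flag_h_insert:
  assumes t: "t \<in> carrier L" and S: "S \<subseteq> {..<s}"
  shows "(\<Sum>w\<in>level t s. lower_flag_h w S) = lower_flag_h t (insert s S) + lower_flag_h t S"
proof -
  let ?f = "\<lambda>t T. int (card (lower_chains t T))"
  have fin: "finite S" using S finite_subset by blast
  have s: "s \<notin> S" using S by blast
  have sign: "card (insert s S) - card T = Suc (card S - card T)"
      "card (insert s S) - card (insert s T) = card S - card T" if "T \<in> Pow S" for T
    using that fin s card_mono[of S T] finite_subset[of T S] by (auto simp: card_insert_if)
  have inj: "inj_on (insert s) (Pow S)" using s by (intro inj_onI) (metis PowD insert_ident subsetD)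
  have "lower_flag_h t (insert s S) =
      (\<Sum>T\<in>Pow S. (-1) ^ (card (insert s S) - card T) * ?f t T) +
      (\<Sum>T\<in>insert s ` Pow S. (-1) ^ (card (insert s S) - card T) * ?f t T)"
    unfolding lower_flag_h_def Pow_insert using fin s by (intro sum.union_disjoint) auto
  also have "(\<Sum>T\<in>Pow S. (-1) ^ (card (insert s S) - card T) * ?f t T) = - lower_flag_h t S"
    unfolding lower_flag_h_def sum_negf[symmetric]
    by (rule sum.cong[OF HOL.refl]) (simp add: sign(1))
  also have "(\<Sum>T\<in>insert s ` Pow S. (-1) ^ (card (insert s S) - card T) * ?f t T) =
      (\<Sum>T\<in>Pow S. (-1) ^ (card S - card T) * ?f t (insert s T))"
    unfolding sum.reindex[OF inj] o_def by (rule sum.cong[OF HOL.refl]) (simp only: sign(2))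
  also have "\<dots> = (\<Sum>T\<in>Pow S. \<Sum>w\<in>level t s. (-1) ^ (card S - card T) * ?f w T)"
  proof (rule sum.cong[OF HOL.refl])
    fix T assume "T \<in> Pow S"
    then have "T \<subseteq> {..<s}" using S by blast
    then show "(-1) ^ (card S - card T) * ?f t (insert s T) =
        (\<Sum>w\<in>level t s. (-1) ^ (card S - card T) * ?f w T)"
      by (simp only: card_lower_chains_insert[OF t] of_nat_sum sum_distrib_left)
  qed
  also have "\<dots> = (\<Sum>w\<in>level t s. lower_flag_h w S)"
    unfolding lower_flag_h_def by (rule sum.swap)
  finally show ?thesis by simp
qed

definition lower_poly :: "'a \<Rightarrow> nat \<Rightarrow> int poly" where
  "lower_poly t n = (if n = 0 then 0 else good_poly (lower_flag_h t) (n - 1))"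

definition chow_row :: "'a \<Rightarrow> int poly" where
  "chow_row t = (if t = \<bottom> then 1 else [:0, 1:] * lower_poly t (\<rho> t - 1))"

lemma sum_level_0:
  assumes "t \<in> carrier L" "t \<noteq> \<bottom>"
  shows "(\<Sum>w\<in>level t 0. chow_row w) = lower_poly t 1"
proof -
  have "level t 0 = {\<bottom>}" using assms bottom_lless rank_eq_0_iff by auto
  then show ?thesis
    by (simp add: chow_row_def lower_poly_def good_poly_0 lower_flag_h_empty one_pCons)
qed

lemma sum_level_Suc:
  assumes t: "t \<in> carrier L"
  shows "(\<Sum>w\<in>level t (Suc k). chow_row w) =
    lower_poly t (Suc (Suc k)) - [:1, 1:] * lower_poly t (Suc k) + [:0, 1:] * lower_poly t k"
proof -
  have row: "chow_row w = [:0, 1:] * lower_poly w k" if "w \<in> level t (Suc k)" for w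
    using that rank_bottom by (auto simp: chow_row_def)
  show ?thesis
  proof (cases k)
    case 0
    have "(\<Sum>w\<in>level t (Suc k). chow_row w) = 0"
      using row unfolding 0 by (intro sum.neutral) (simp add: lower_poly_def)
    then show ?thesis unfolding 0
      by (simp add: lower_poly_def good_poly_0 good_poly_1)
  next
    case (Suc j)
    have "(\<Sum>w\<in>level t (Suc k). chow_row w) = (\<Sum>w\<in>level t (Suc k). [:0, 1:] * lower_poly w k)"
      using row by (rule sum.cong[OF HOL.refl])
    also have "\<dots> = [:0, 1:] * good_poly (\<lambda>S. \<Sum>w\<in>level t (Suc k). lower_flag_h w S) j"
      unfolding good_poly_sum sum_distrib_left by (simp add: lower_poly_def Suc)
    also have "good_poly (\<lambda>S. \<Sum>w\<in>level t (Suc k). lower_flag_h w S) j =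
        good_poly (\<lambda>S. lower_flag_h t (insert (Suc k) S) + lower_flag_h t S) j"
      using t by (intro good_poly_cong lower_flag_h_insert) (auto simp: Suc)
    finally show ?thesis
      unfolding good_poly_add by (simp add: lower_poly_def Suc good_poly_Suc_Suc algebra_simps)
  qed
qed

lemma sum_below_by_rank:
  assumes t: "t \<in> carrier L" "t \<noteq> \<bottom>"
  shows "(\<Sum>w | w \<in> carrier L \<and> w \<sqsubset> t. chow_row w * g (\<rho> w)) =
    (\<Sum>s\<le>\<rho> t - 1. (\<Sum>w\<in>level t s. chow_row w) * g s)"
proof -
  have "(\<Sum>s\<le>\<rho> t - 1. (\<Sum>w\<in>level t s. chow_row w) * g s) =
      (\<Sum>s\<le>\<rho> t - 1. \<Sum>w\<in>level t s. chow_row w * g (\<rho> w))"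
    unfolding sum_distrib_right by (intro sum.cong) auto
  also have "\<dots> = (\<Sum>w | w \<in> carrier L \<and> w \<sqsubset> t. chow_row w * g (\<rho> w))"
  proof (rule sum.group)
    show "\<rho> ` {w \<in> carrier L. w \<sqsubset> t} \<subseteq> {..\<rho> t - 1}"
      using rank_strict_mono[OF _ t(1)] by fastforce
  qed (simp_all add: finite_carrier)
  finally show ?thesis ..
qed

lemma chow_fun_bottom:
  assumes t: "t \<in> carrier L" "t \<noteq> \<bottom>"
  shows "chow_fun L \<rho> \<bottom> t = good_poly (lower_flag_h t) (\<rho> t - 1)"
proof -
  have pos: "\<rho> v = Suc (\<rho> v - 1)" if "v \<in> carrier L" "v \<noteq> \<bottom>" for v
    using rank_eq_0_iff[OF that(1)] that(2) by simp
  have "chow_fun L \<rho> \<bottom> t = chow_row t + (\<Sum>w | w \<in> carrier L \<and> w \<sqsubset> t. chow_row w)"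
  proof (rule chow_fun_eq[OF _ _ t(1)])
    show "chow_row \<bottom> = 1" by (simp add: chow_row_def)
    fix v assume v: "v \<in> carrier L" "v \<noteq> \<bottom>"
    have "(\<Sum>w | w \<in> carrier L \<and> w \<sqsubset> v. chow_row w * gap_poly (\<rho> v - \<rho> w)) =
        (\<Sum>s\<le>\<rho> v - 1. (\<Sum>w\<in>level v s. chow_row w) * gap_poly (Suc (\<rho> v - 1) - s))"
      using sum_below_by_rank[OF v, of "\<lambda>s. gap_poly (\<rho> v - s)"] pos[OF v] by simp
    also have "\<dots> = [:0, 1:] * lower_poly v (\<rho> v - 1)"
      by (rule sum_second_difference_gap_poly)
        (simp_all only: sum_level_0[OF v] sum_level_Suc[OF v(1)], simp add: lower_poly_def)
    finally show "chow_row v =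
        (\<Sum>w | w \<in> carrier L \<and> w \<sqsubset> v. chow_row w * gap_poly (\<rho> v - \<rho> w))"
      using v by (simp add: chow_row_def)
  qed
  also have "(\<Sum>w | w \<in> carrier L \<and> w \<sqsubset> t. chow_row w) =
      (\<Sum>s\<le>\<rho> t - 1. \<Sum>w\<in>level t s. chow_row w)"
    using sum_below_by_rank[OF t, of "\<lambda>_. 1"] by simp
  also have "\<dots> = lower_poly t (Suc (\<rho> t - 1)) - [:0, 1:] * lower_poly t (\<rho> t - 1)"
    by (rule sum_second_difference)
      (simp_all only: sum_level_0[OF t] sum_level_Suc[OF t(1)], simp add: lower_poly_def)
  finally show ?thesis using t by (simp add: chow_row_def lower_poly_def)
qed

lemma lower_flag_h_top:
  assumes "S \<subseteq> {1..\<rho> \<top> - 1}"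
  shows "lower_flag_h \<top> S = flag_h L \<rho> S"
proof -
  have "card (lower_chains \<top> T) = flag_f L \<rho> T" if "T \<in> Pow S" for T
  proof -
    have "\<rho> \<top> \<notin> T"
    proof
      assume "\<rho> \<top> \<in> T"
      then have "\<rho> \<top> \<in> {1..\<rho> \<top> - 1}" using that assms by blast
      then show False by auto
    qed
    then have "lower_chains \<top> T =
        {C. C \<subseteq> carrier L \<and> Complete_Partial_Order.chain (\<sqsubseteq>) C \<and> \<rho> ` C = T}"
      by (auto simp: lower_chains_def lless_eq)
    then show ?thesis by (simp add: flag_f_def)
  qed
  then show ?thesis by (simp add: lower_flag_h_def flag_h_def)
qed

lemma chow_poly_eq_good_poly:
  assumes "\<rho> \<top> \<ge> 1"
  shows "chow_poly L \<rho> = good_poly (flag_h L \<rho>) (\<rho> \<top> - 1)"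
proof -
  have "\<top> \<noteq> \<bottom>" using assms rank_bottom by force
  then have "chow_poly L \<rho> = good_poly (lower_flag_h \<top>) (\<rho> \<top> - 1)"
    by (simp add: chow_poly_def chow_fun_bottom)
  also have "\<dots> = good_poly (flag_h L \<rho>) (\<rho> \<top> - 1)"
    by (rule good_poly_cong[OF lower_flag_h_top])
  finally show ?thesis .
qed

end

section \<open>The \<open>\<gamma>\<close>-expansion\<close>

lemma sum_good_by_card:
  "(\<Sum>S | S \<subseteq> {1..n} \<and> good S. h S) =
   (\<Sum>i = 0..n div 2. \<Sum>S | S \<in> {S. S \<subseteq> {1..n} \<and> good S} \<and> card S = i. h S)"
proof (rule sum.group[symmetric])
  have "card S \<le> n div 2" if "S \<subseteq> {1..n}" "good S" for S
    using card_good[OF that] by linarith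
  then show "card ` {S. S \<subseteq> {1..n} \<and> good S} \<subseteq> {0..n div 2}" by auto
qed simp_all

lemma good_poly_gamma:
  fixes b :: "nat set \<Rightarrow> int" and n :: nat
  defines "c i \<equiv> \<Sum>S | S \<in> {S. S \<subseteq> {1..n} \<and> good S} \<and> card S = i. b S"
  shows "good_poly b n = (\<Sum>i = 0..n div 2. smult (c i) (monom 1 i * [:1, 1:] ^ (n - 2 * i)))"
    and "(\<Sum>S | S \<subseteq> {1..n} \<and> good S. monom (b S) (card S)) = (\<Sum>i = 0..n div 2. monom (c i) i)"
  unfolding good_poly_def sum_good_by_card c_def smult_sum monom_sum
  by (intro sum.cong; simp)+

lemma gamma_unique:
  fixes c d :: "nat \<Rightarrow> int"
  assumes "(\<Sum>i = 0..n div 2. smult (c i) (monom 1 i * [:1, 1:] ^ (n - 2 * i))) =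
      (\<Sum>i = 0..n div 2. smult (d i) (monom 1 i * [:1, 1:] ^ (n - 2 * i)))"
    and "i \<le> n div 2"
  shows "c i = d i"
proof -
  have "(\<Sum>i\<le>n div 2. smult (c i - d i) (monom 1 i * [:1, 1:] ^ (n - 2 * i))) = 0"
    using assms(1) by (simp add: smult_diff_left sum_subtractf atLeast0AtMost)
  then have "c i - d i = 0"
    by (rule monom_mult_coeff_independent[rotated])
      (use assms(2) in \<open>simp_all add: coeff_0_power\<close>)
  then show ?thesis by simp
qed

theorem theorem4p25:
  fixes L :: "('a, 'm) gorder_scheme" and \<rho> :: "'a \<Rightarrow> nat" and r :: nat
  assumes "finite_graded_bounded_poset L \<rho>"
    and "r = \<rho> \<top>\<^bsub>L\<^esub>" and "r \<ge> 1"
  shows "(\<exists>\<gamma> :: nat \<Rightarrow> int. chow_poly L \<rho> =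
            (\<Sum>i = 0..(r - 1) div 2. smult (\<gamma> i) (monom 1 i * [:1, 1:] ^ (r - 1 - 2 * i)))) \<and>
         (\<forall>\<gamma> :: nat \<Rightarrow> int. chow_poly L \<rho> =
            (\<Sum>i = 0..(r - 1) div 2. smult (\<gamma> i) (monom 1 i * [:1, 1:] ^ (r - 1 - 2 * i))) \<longrightarrow>
            (\<Sum>i = 0..(r - 1) div 2. monom (\<gamma> i) i) =
            (\<Sum>S | S \<subseteq> {1..r - 1} \<and> good S. monom (flag_h L \<rho> S) (card S)))"
proof -
  interpret finite_graded_bounded_poset L \<rho> by (rule assms(1))
  let ?expand = "\<lambda>\<gamma>. \<Sum>i = 0..(r - 1) div 2. smult (\<gamma> i) (monom 1 i * [:1, 1:] ^ (r - 1 - 2 * i))"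
  define c where "c i =
    (\<Sum>S | S \<in> {S. S \<subseteq> {1..r - 1} \<and> good S} \<and> card S = i. flag_h L \<rho> S)" for i
  have chow: "chow_poly L \<rho> = ?expand c"
    using chow_poly_eq_good_poly assms(2,3) unfolding c_def by (simp only: good_poly_gamma(1))
  have "(\<Sum>i = 0..(r - 1) div 2. monom (\<gamma> i) i) =
      (\<Sum>S | S \<subseteq> {1..r - 1} \<and> good S. monom (flag_h L \<rho> S) (card S))"
    if "chow_poly L \<rho> = ?expand \<gamma>" for \<gamma>
  proof -
    have "\<gamma> i = c i" if "i \<le> (r - 1) div 2" for i
      using gamma_unique[of \<gamma> "r - 1" c i] chow \<open>chow_poly L \<rho> = ?expand \<gamma>\<close> that by simp
    then show ?thesis unfolding good_poly_gamma(2) c_def[symmetric] by (intro sum.cong) simp_all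
  qed
  then show ?thesis using chow by blast
qed

end
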